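(* Assume that the dimension of the state space is $N$. Let $\bar y_{n,t}$ denote the upper limit of the $n$-th stage-$t$ state variable $y_{n,t}$, $n=1,\dots,N$, put $\beta=\sum_{n=1}^N \bar y_{n,t}$, and let $\mathbf{e}_1,\dots,\mathbf{e}_N$ be the canonical basis of $\mathbb{R}^N$. Then the $N+1$ initialized candidate points $$\{\beta\mathbf{e}_1,\ \dots,\ \beta\mathbf{e}_n,\ \dots,\ \beta\mathbf{e}_N,\ \boldsymbol{0}\}$$ guarantee the feasibility of the convex combination in the stage-$t$ upper-bound problem. That is, writing these points as $\boldsymbol{y}_t^1,\dots,\boldsymbol{y}_t^{N+1}$, for every feasible state $\boldsymbol{y}_t\in\mathcal{Y}_t$ there exist $\lambda_1,\dots,\lambda_{N+1}\ge 0$ with $\sum_{j=1}^{N+1}\lambda_j=1$ and $\boldsymbol{y}_t=\sum_{j=1}^{N+1}\lambda_j\boldsymbol{y}_t^j$, so that imposing the convex-combination constraint with these points does not make the upper-bound problem infeasible.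
   Context: In a multistage robust optimization problem with given binary decisions $\boldsymbol{x}$, the stage-$t$ state (dispatch decision) vector is $\boldsymbol{y}_t=(y_{1,t},\dots,y_{N,t})$, with feasible region $\mathcal{Y}_t$; each variable $y_{n,t}$ has a lower limit $\underline{y}_{n,t}$ and an upper limit $\bar y_{n,t}$. The stage-$t$ upper-bound problem (inner approximation of the worst-case cost-to-go function) at a previous state $\boldsymbol{y}_{t-1}$ is $$\bar F_t(\boldsymbol{y}_{t-1})=\max_{\boldsymbol{\xi}_t\in\Xi_t}\ \min_{\boldsymbol{y}_t,\boldsymbol{\lambda}}\ \mathbf{b}_t^\top\boldsymbol{y}_t+\sum_j\lambda_j\bar{\mathcal{F}}_{t+1}(\boldsymbol{y}_t^j)$$ subject to $\mathbf{B}_t\boldsymbol{y}_t\ge\mathbf{h}_t(\boldsymbol{x})-\mathbf{A}_t\boldsymbol{y}_{t-1}+\mathbf{H}_t\boldsymbol{\xi}_t$, $\boldsymbol{y}_t\in\mathcal{Y}_t$, and the convex-combination constraint $\boldsymbol{y}_t=\sum_j\lambda_j\boldsymbol{y}_t^j$, $\lambda_j\ge 0$, $\sum_j\lambda_j=1$. Here $\{(\boldsymbol{y}_t^j,\bar{\mathcal{F}}_{t+1}(\boldsymbol{y}_t^j))\}_j$ are the candidate points with their associated upper bounds on the stage-$(t+1)$ worst-case cost-to-go; $\Xi_t$ is the uncertainty set of the stage-$t$ uncertain vector $\boldsymbol{\xi}_t$; $\mathbf{A}_t,\mathbf{B}_t,\mathbf{H}_t,\mathbf{b}_t,\mathbf{h}_t(\boldsymbol{x})$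 are given matrices and vectors. The set of candidate points is initialized with the $N+1$ points of the claim and is expanded as the cost-to-go functions are updated.
   Formalization: The lower limits of the state variables are assumed nonnegative; without this the claim fails, e.g. N = 1 and feasible region [-1, 1], where the candidate points are 1 and 0 and the state -1 is not a convex combination of them. *)

theory Defs
  imports "HOL-Analysis.Analysis"
begin

text \<open>A state of dimension N is a vector of type \<open>real ^ 'n\<close> with N = \<open>CARD('n)\<close>. Families of candidate
  points are indexed by a finite type; the N + 1 initial points are indexed by \<open>'n option\<close>, where
  \<open>Some n\<close> stands for the n-th scaled basis vector and \<open>None\<close> for the origin.\<close>

definition initial_points :: "real ^ 'n \<Rightarrow> 'n option \<Rightarrow> real ^ 'n" where
  "initial_points yup j =
     (case j of
        Some n \<Rightarrow> (\<Sum>k\<in>UNIV. yup $ k) *\<^sub>R axis n 1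
      | None \<Rightarrow> 0)"

definition convex_comb_constraint ::
    "('j::finite \<Rightarrow> real ^ 'n) \<Rightarrow> real ^ 'n \<Rightarrow> ('j \<Rightarrow> real) \<Rightarrow> bool" where
  "convex_comb_constraint P y lam \<longleftrightarrow>
     y = (\<Sum>j\<in>UNIV. lam j *\<^sub>R P j) \<and> (\<forall>j. lam j \<ge> 0) \<and> (\<Sum>j\<in>UNIV. lam j) = 1"

text \<open>The order on vectors is componentwise. The argument \<open>h\<close> is the vector obtained by evaluating
  the right-hand side at the given binary decisions.\<close>

definition dispatch_feasible ::
    "real ^ 'n ^ 'm \<Rightarrow> real ^ 'm \<Rightarrow> real ^ 'n ^ 'm \<Rightarrow> real ^ 'k ^ 'm \<Rightarrow> (real ^ 'n) set \<Rightarrow>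
     real ^ 'n \<Rightarrow> real ^ 'k \<Rightarrow> (real ^ 'n) set" where
  "dispatch_feasible B h A H Y yprev \<xi> =
     {y. B *v y \<ge> h - A *v yprev + H *v \<xi> \<and> y \<in> Y}"

text \<open>Feasible pairs of the inner minimisation in the upper-bound problem, for a fixed realisation
  \<open>\<xi>\<close>. The costs attached to the candidate points enter only the objective.\<close>

definition upper_bound_feasible ::
    "real ^ 'n ^ 'm \<Rightarrow> real ^ 'm \<Rightarrow> real ^ 'n ^ 'm \<Rightarrow> real ^ 'k ^ 'm \<Rightarrow> (real ^ 'n) set \<Rightarrow>
     ('j::finite \<Rightarrow> real ^ 'n) \<Rightarrow> real ^ 'n \<Rightarrow> real ^ 'k \<Rightarrow> ((real ^ 'n) \<times> ('j \<Rightarrow> real)) set" where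
  "upper_bound_feasible B h A H Y P yprev \<xi> =
     {(y, lam). y \<in> dispatch_feasible B h A H Y yprev \<xi> \<and> convex_comb_constraint P y lam}"

end

theory Submission
  imports Defs
begin

text \<open>
  Nonnegative states below the upper limits have coordinate sum at most \<open>\<beta>\<close>, the sum of the upper
  limits, so they lie in the simplex \<open>{y. y \<ge> 0 \<and> (\<Sum>n. y $ n) \<le> \<beta>}\<close>, whose vertices are exactly the
  initial points. The barycentric coordinates are explicit: the vertex \<open>\<beta> e\<^sub>n\<close> gets weight
  \<open>y $ n / \<beta>\<close>, and the origin gets the remaining weight (\<open>convex_comb_initial_points\<close>). Nonnegativity
  of the lower limits is what places the states in this simplex.

  Adding candidate points can only enlarge their convex hull, so the constraint stays satisfiable
  when points are added (\<open>convex_comb_range_mono\<close>). Since every state in the feasible region can be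
  written as a convex combination of the candidates, the additional constraint excludes no dispatch
  decision.
\<close>

lemma sum_UNIV_option:
  fixes f :: "'a::finite option \<Rightarrow> 'b::comm_monoid_add"
  shows "(\<Sum>j\<in>UNIV. f j) = f None + (\<Sum>a\<in>UNIV. f (Some a))"
  by (simp add: UNIV_option_conv sum.reindex)

lemma sum_axis_eq:
  fixes y :: "real ^ 'n"
  shows "(\<Sum>n\<in>UNIV. (y $ n) *\<^sub>R axis n 1) = y"
  using basis_expansion[of y] by (simp add: scalar_mult_eq_scaleR)

lemma convex_comb_initial_points:
  fixes y yup :: "real ^ 'n"
  assumes nonneg: "\<And>n. 0 \<le> y $ n" and upper: "\<And>n. y $ n \<le> yup $ n"
  shows "\<exists>lam. convex_comb_constraint (initial_points yup) y lam"
proof -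
  define \<beta> where "\<beta> = (\<Sum>k\<in>UNIV. yup $ k)"
  define lam where
    "lam j = (case j of Some n \<Rightarrow> y $ n / \<beta> | None \<Rightarrow> 1 - (\<Sum>n\<in>UNIV. y $ n) / \<beta>)" for j
  have sum_le: "(\<Sum>n\<in>UNIV. y $ n) \<le> \<beta>"
    unfolding \<beta>_def by (intro sum_mono upper)
  have sum_nonneg: "0 \<le> (\<Sum>n\<in>UNIV. y $ n)"
    by (intro sum_nonneg nonneg)
  have \<beta>_nonneg: "0 \<le> \<beta>"
    using sum_nonneg sum_le by linarith
  \<comment> \<open>If \<open>\<beta> = 0\<close>, all candidates coincide with the origin, but then so does \<open>y\<close>; division by zero
    yields zero, so the weights then put everything on the origin and need no separate definition.\<close>
  have scaled: "(y $ n / \<beta>) * \<beta> = y $ n" for n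
  proof (cases "\<beta> = 0")
    case True
    then have "(\<Sum>n\<in>UNIV. y $ n) = 0"
      using sum_le sum_nonneg by linarith
    then have "y $ n = 0"
      using nonneg by (simp add: sum_nonneg_eq_0_iff)
    then show ?thesis by simp
  qed simp
  have "(\<Sum>j\<in>UNIV. lam j *\<^sub>R initial_points yup j)
      = (\<Sum>n\<in>UNIV. ((y $ n / \<beta>) * \<beta>) *\<^sub>R axis n 1)"
    by (simp add: sum_UNIV_option lam_def initial_points_def \<beta>_def)
  also have "\<dots> = y"
    unfolding scaled by (rule sum_axis_eq)
  finally have "y = (\<Sum>j\<in>UNIV. lam j *\<^sub>R initial_points yup j)" ..
  moreover have "0 \<le> lam j" for j
    using nonneg \<beta>_nonneg sum_le
    by (cases j) (auto simp: lam_def divide_le_eq_1)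
  moreover have "(\<Sum>j\<in>UNIV. lam j) = 1"
    by (simp add: sum_UNIV_option lam_def sum_divide_distrib)
  ultimately show ?thesis
    unfolding convex_comb_constraint_def by blast
qed

text \<open>Each \<open>Q j\<close> occurs as some \<open>P (g j)\<close>; pushing the weights forward along \<open>g\<close> preserves total mass
  and barycentre. The map \<open>g\<close> may merge indices, since \<open>Q\<close> may repeat points (as the initial points do
  when the upper limits vanish).\<close>

lemma convex_comb_range_mono:
  fixes Q :: "'i::finite \<Rightarrow> real ^ 'n" and P :: "'j::finite \<Rightarrow> real ^ 'n"
  assumes range: "range Q \<subseteq> range P" and comb: "convex_comb_constraint Q y lam"
  shows "\<exists>lam'. convex_comb_constraint P y lam'"
proof -
  from range have "\<forall>j. \<exists>i. Q j = P i" by blast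
  then obtain g where g: "\<And>j. Q j = P (g j)" by metis
  define lam' where "lam' i = (\<Sum>j\<in>{j\<in>UNIV. g j = i}. lam j)" for i
  have "(\<Sum>i\<in>UNIV. lam' i *\<^sub>R P i) = (\<Sum>i\<in>UNIV. \<Sum>j\<in>{j\<in>UNIV. g j = i}. lam j *\<^sub>R Q j)"
    unfolding lam'_def scaleR_left.sum by (intro sum.cong) (auto simp: g)
  also have "\<dots> = (\<Sum>j\<in>UNIV. lam j *\<^sub>R Q j)"
    by (rule sum.group) auto
  also have "\<dots> = y"
    using comb by (simp add: convex_comb_constraint_def)
  finally have "y = (\<Sum>i\<in>UNIV. lam' i *\<^sub>R P i)" ..
  moreover have "0 \<le> lam' i" for i
    using comb unfolding lam'_def convex_comb_constraint_def by (intro sum_nonneg) auto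
  moreover have "(\<Sum>i\<in>UNIV. lam' i) = (\<Sum>j\<in>UNIV. lam j)"
    unfolding lam'_def by (rule sum.group) auto
  ultimately have "convex_comb_constraint P y lam'"
    using comb by (simp add: convex_comb_constraint_def)
  then show ?thesis by blast
qed

lemma upper_bound_feasible_nonempty:
  assumes feasible: "dispatch_feasible B h A H Y yprev \<xi> \<noteq> {}"
    and representable: "\<forall>y\<in>Y. \<exists>lam. convex_comb_constraint P y lam"
  shows "upper_bound_feasible B h A H Y P yprev \<xi> \<noteq> {}"
proof -
  from feasible obtain y where y: "y \<in> dispatch_feasible B h A H Y yprev \<xi>" by blast
  then have "y \<in> Y" by (simp add: dispatch_feasible_def)
  with representable obtain lam where "convex_comb_constraint P y lam" by blast
  with y have "(y, lam) \<in> upper_bound_feasible B h A H Y P yprev \<xi>"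
    by (simp add: upper_bound_feasible_def)
  then show ?thesis by blast
qed

theorem proposition0:
  fixes ylow yup :: "real ^ 'n"
    and Y :: "(real ^ 'n) set"
    and A B :: "real ^ 'n ^ 'm"
    and H :: "real ^ 'k ^ 'm"
    and h :: "real ^ 'd \<Rightarrow> real ^ 'm"
    and x :: "real ^ 'd"
    and \<Xi> :: "(real ^ 'k) set"
    and P :: "'j::finite \<Rightarrow> real ^ 'n"
  assumes x_binary: "\<forall>i. x $ i \<in> {0, 1}"
    and limits: "\<forall>y\<in>Y. \<forall>n. ylow $ n \<le> y $ n \<and> y $ n \<le> yup $ n"
    and lower_nonneg: "\<forall>n. 0 \<le> ylow $ n"
    and expanded: "range (initial_points yup) \<subseteq> range P"
  shows "(\<forall>y\<in>Y. \<exists>lam. convex_comb_constraint (initial_points yup) y lam) \<and>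
    (\<forall>yprev. \<forall>\<xi>\<in>\<Xi>. dispatch_feasible B (h x) A H Y yprev \<xi> \<noteq> {} \<longrightarrow>
       upper_bound_feasible B (h x) A H Y (initial_points yup) yprev \<xi> \<noteq> {} \<and>
       upper_bound_feasible B (h x) A H Y P yprev \<xi> \<noteq> {})"
proof -
  have init: "\<forall>y\<in>Y. \<exists>lam. convex_comb_constraint (initial_points yup) y lam"
    using limits lower_nonneg by (meson convex_comb_initial_points order_trans)
  then have "\<forall>y\<in>Y. \<exists>lam. convex_comb_constraint P y lam"
    using convex_comb_range_mono[OF expanded] by blast
  with init show ?thesis
    by (simp add: upper_bound_feasible_nonempty)
qed

end
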